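(* Let $0<a<1$ and $\alpha>1$. Then the condition $\|\Omega\|_{\mathcal{K}_a}<\infty$ and membership of $\Omega$ in $L(\log L)^\alpha(\mathbb{S}^1)$ are mutually incomparable, i.e.: (i) there exists an integrable function $\Omega$ on $\mathbb{S}^1$ such that $\|\Omega\|_{\mathcal{K}_a}<\infty$ but $\Omega\notin L(\log L)^\alpha(\mathbb{S}^1)$; (ii) there exists a function $\Omega\in L(\log L)^\alpha(\mathbb{S}^1)$ such that $\|\Omega\|_{\mathcal{K}_a}=\infty$.
   Context: $\mathbb{S}^1$ is the unit circle in $\mathbb{R}^2$ and $\sigma$ is arc-length measure on it. For $0<a<1$ and measurable $\Omega$ on $\mathbb{S}^1$, $$\|\Omega\|_{\mathcal{K}_a}:=\sup_{\xi\in\mathbb{S}^1}\int_{\mathbb{S}^1}\frac{|\Omega(\theta)|}{|\theta\cdot\xi|^a}\,d\sigma(\theta).$$ For $\alpha\ge0$, one writes $\Omega\in L(\log L)^\alpha(\mathbb{S}^1)$ when $\Omega$ is measurable and $$\int_{\mathbb{S}^1}|\Omega(\theta)|\big(\log(e+|\Omega(\theta)|)\big)^\alpha\,d\sigma(\theta)<\infty.$$ *)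

theory Defs
  imports "HOL-Analysis.Analysis"
begin

abbreviation circle :: "(real ^ 2) set" where
  "circle \<equiv> sphere 0 1"

definition circle_point :: "real \<Rightarrow> real ^ 2" where
  "circle_point t = vector [cos t, sin t]"

text \<open>
  Arc-length measure, on the Borel sets of the circle: the image of Lebesgue measure on
  \<open>[0, 2\<pi>)\<close> under the unit-speed parametrization.
\<close>

definition arc_length :: "(real ^ 2) measure" where
  "arc_length =
     distr (restrict_space lborel {0..<2 * pi}) (restrict_space borel circle) circle_point"

text \<open>
  The quotient is taken in \<^typ>\<open>ennreal\<close>, so that on the (null) set where \<open>\<theta> \<bullet> \<xi> = 0\<close> the
  integrand is \<open>\<infinity>\<close>, unless \<open>\<Omega> \<theta> = 0\<close>, when it is \<open>0\<close>.
\<close>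

definition K_norm :: "real \<Rightarrow> (real ^ 2 \<Rightarrow> real) \<Rightarrow> ennreal" where
  "K_norm a \<Omega> =
     (SUP \<xi>\<in>circle. \<integral>\<^sup>+\<theta>. ennreal \<bar>\<Omega> \<theta>\<bar> / ennreal (\<bar>\<theta> \<bullet> \<xi>\<bar> powr a) \<partial>arc_length)"

definition LlogL :: "real \<Rightarrow> (real ^ 2 \<Rightarrow> real) set" where
  "LlogL \<alpha> =
     {\<Omega> \<in> borel_measurable arc_length.
        (\<integral>\<^sup>+\<theta>. ennreal (\<bar>\<Omega> \<theta>\<bar> * ln (exp 1 + \<bar>\<Omega> \<theta>\<bar>) powr \<alpha>) \<partial>arc_length) < \<infinity>}"

lemma circle_point_in_circle: "circle_point t \<in> circle"
  by (simp add: circle_point_def norm_eq_1 inner_vec_def sum_2 power2_eq_square[symmetric])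

lemma measurable_circle_point:
  "circle_point \<in> restrict_space lborel {0..<2 * pi} \<rightarrow>\<^sub>M restrict_space borel circle"
proof -
  have eq: "circle_point = (\<lambda>t. cos t *\<^sub>R axis 1 1 + sin t *\<^sub>R axis 2 1)"
    by (simp add: fun_eq_iff vec_eq_iff forall_2 circle_point_def axis_def)
  have "continuous_on UNIV circle_point"
    unfolding eq by (intro continuous_intros)
  then have "circle_point \<in> borel_measurable borel"
    by (rule borel_measurable_continuous_onI)
  then have "circle_point \<in> borel_measurable lborel"
    by simp
  then have "circle_point \<in> borel_measurable (restrict_space lborel {0..<2 * pi})"
    by (rule measurable_restrict_space1)
  then show ?thesis
    by (rule measurable_restrict_space2[rotated]) (use circle_point_in_circle in blast)
qed

lemma space_arc_length: "space arc_length = circle"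
  by (simp add: arc_length_def space_restrict_space)

lemma emeasure_arc_length_circle: "emeasure arc_length circle = ennreal (2 * pi)"
proof -
  have sets: "circle \<in> sets (restrict_space borel circle)"
    using sets.top[of "restrict_space borel circle"] by (simp add: space_restrict_space)
  have vimage: "circle_point -` circle \<inter> {0..<2 * pi} = {0..<2 * pi}"
    using circle_point_in_circle by blast
  have "emeasure arc_length circle =
      emeasure (restrict_space lborel {0..<2 * pi}) {0..<2 * pi}"
    unfolding arc_length_def
    by (subst emeasure_distr[OF measurable_circle_point sets])
       (simp only: vimage space_restrict_space2[of "{0..<2 * pi}" lborel] sets_lborel atLeastLessThan_borel)
  also have "\<dots> = ennreal (2 * pi)"
    by (subst emeasure_restrict_space) simp_all
  finally show ?thesis .
qed

end

theory Submission
  imports Defs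
begin

text \<open>
  The kernel \<open>1 / \<bar>\<theta> \<bullet> \<xi>\<bar>\<^sup>a\<close> sees where \<open>\<Omega>\<close> is large, whereas the class \<open>L (log L)\<^sup>\<alpha>\<close> sees only how
  large \<open>\<Omega>\<close> is: it is invariant under rearrangement. Spreading a function evenly over the circle
  therefore helps with the first condition and not with the second, and concentrating it at the
  zero of a kernel hurts the first more than the second. In the coordinate
  \<open>\<theta> = circle_point t\<close>, the kernel at \<open>\<xi>\<close> is a translate of \<open>1 / \<bar>sin t\<bar>\<^sup>a\<close>, which is integrable
  because \<open>a < 1\<close>.

  \<^bold>\<open>Finite norm, outside the class.\<close> For every \<open>n\<close> there is a set \<open>A\<close> of measure \<open>2 \<pi> / n\<close> such that
  all integrals of the kernels over \<open>A\<close> are at most \<open>C / n\<close>, with \<open>C\<close> independent of \<open>n\<close>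
  (\<open>exists_evenly_spread\<close>). It consists of the initial \<open>n\<close>-th parts of the cells of a very fine
  partition into arcs of equal length. For a kernel truncated at height \<open>\<epsilon>\<^sup>-\<^sup>a\<close>, which varies by at
  most \<open>1\<close> over a cell, the mean over \<open>A\<close> exceeds the mean over the circle by at most \<open>1\<close>
  (\<open>nn_integral_cell_starts_le\<close>). The remainder of the kernel is at most \<open>\<epsilon>\<^sup>b\<^sup>-\<^sup>a / \<bar>sin t\<bar>\<^sup>b\<close> for any
  fixed \<open>b\<close> with \<open>a < b < 1\<close> (\<open>sin_kernel_split\<close>), so its integral is at most \<open>1 / n\<close> once \<open>\<epsilon>\<close> is
  small. Thus the functions \<open>n 1\<^sub>A\<close> have norms bounded by \<open>C\<close>, although their heights
  are arbitrary. In the sum of \<open>2\<^sup>-\<^sup>m n\<^sub>m 1\<^sub>A\<close> over \<open>m\<close>, with \<open>A = A\<^sub>m\<close> belonging to \<open>n\<^sub>m\<close>, the norm is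
  at most \<open>2 C\<close>, but the \<open>m\<close>-th summand alone
  contributes \<open>2 \<pi> 2\<^sup>-\<^sup>m (log (e + 2\<^sup>-\<^sup>m n\<^sub>m))\<^sup>\<alpha>\<close> to the logarithmic integral, and this is at least \<open>m\<close> if
  \<open>n\<^sub>m\<close> grows fast enough (\<open>K_norm_finite_not_LlogL\<close>).

  \<^bold>\<open>Infinite norm, inside the class.\<close> The function \<open>\<bar>sin t\<bar>\<^sup>a\<^sup>-\<^sup>1\<close> lies in \<open>L\<^sup>p\<close> for some \<open>p > 1\<close>, hence in
  \<open>L (log L)\<^sup>\<alpha>\<close>, while against the kernel \<open>1 / \<bar>sin t\<bar>\<^sup>a\<close> it gives the divergent integral of
  \<open>1 / \<bar>sin t\<bar>\<close> (\<open>LlogL_K_norm_infinite\<close>).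
\<close>

section \<open>The kernel in the angular variable\<close>

definition sin_kernel :: "real \<Rightarrow> real \<Rightarrow> ennreal" where
  "sin_kernel b t = inverse (ennreal (\<bar>sin t\<bar> powr b))"

lemma sin_kernel_measurable [measurable]: "sin_kernel b \<in> borel_measurable borel"
  unfolding sin_kernel_def by measurable

lemma inverse_ennreal_antimono:
  fixes x y :: ennreal
  assumes "x \<le> y"
  shows "inverse y \<le> inverse x"
proof (cases "0 < x \<and> y < top")
  case True
  then have "x < top" "0 < y" using assms by (auto intro: le_less_trans less_le_trans)
  with True assms show ?thesis
    by (cases x; cases y) (auto simp: inverse_ennreal ennreal_leI le_imp_inverse_le)
next
  case False
  then show ?thesis by (auto simp: not_less top_unique)
qed

text \<open>
  With \<open>v = \<bar>u\<bar> / 2\<close>, the mean value theorem gives \<open>sin v \<ge> v cos v\<close>, so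
  \<open>sin \<bar>u\<bar> = 2 sin v cos v \<ge> 2 v cos\<^sup>2 v\<close>, and \<open>2 cos\<^sup>2 v = 1 + cos (2 v) \<ge> 1\<close>.
\<close>
lemma half_le_abs_sin:
  fixes u :: real
  assumes "\<bar>u\<bar> \<le> pi / 2"
  shows "\<bar>u\<bar> / 2 \<le> \<bar>sin u\<bar>"
proof -
  define v where "v = \<bar>u\<bar> / 2"
  have v: "0 \<le> v" "2 * v \<le> pi / 2" using assms by (auto simp: v_def)
  have "v * cos v \<le> sin v"
  proof (cases "v = 0")
    case False
    then have "0 < v" using v by simp
    then obtain z where z: "0 < z" "z < v" "sin v - sin 0 = (v - 0) * cos z"
      using MVT2[of 0 v sin cos] DERIV_sin by blast
    have "cos v \<le> cos z" using z v by (intro cos_monotone_0_pi_le) auto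
    then show ?thesis using z v by (simp add: mult_left_mono)
  qed simp
  moreover have cv: "0 \<le> cos v" using v by (intro cos_ge_zero) auto
  ultimately have le: "(v * cos v) * cos v \<le> sin v * cos v" by (rule mult_right_mono)
  have "0 \<le> cos (2 * v)" using v by (intro cos_ge_zero) auto
  then have "1 \<le> 2 * (cos v)\<^sup>2" by (simp add: cos_double_cos)
  then have "v * 1 \<le> v * (2 * (cos v)\<^sup>2)" using v by (intro mult_left_mono) auto
  also have "\<dots> = 2 * ((v * cos v) * cos v)" by (simp add: power2_eq_square)
  also have "\<dots> \<le> 2 * (sin v * cos v)" using le by simp
  also have "\<dots> = sin (2 * v)" by (simp add: sin_double)
  also have "sin (2 * v) = sin \<bar>u\<bar>" by (simp add: v_def)
  also have "\<dots> \<le> \<bar>sin u\<bar>" by (cases "0 \<le> u") auto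
  finally show ?thesis by (simp add: v_def)
qed

lemma nn_integral_powr_from_0_finite:
  fixes b :: real
  assumes "b < 1"
  shows "(\<integral>\<^sup>+u. ennreal ((u / 2) powr - b) * indicator {0..2} u \<partial>lborel) < \<infinity>"
proof -
  have "((\<lambda>x::real. x powr - b) has_integral (2 powr (- b + 1) / (- b + 1))) {0..2}"
    using assms by (intro has_integral_powr_from_0) auto
  then have "((\<lambda>x. 2 powr b * x powr - b) has_integral (2 powr b * (2 powr (- b + 1) / (- b + 1)))) {0..2}"
    by (rule has_integral_mult_right)
  then have "((\<lambda>x. if x \<in> {0..2} then 2 powr b * x powr - b else 0) has_integral
      (2 powr b * (2 powr (- b + 1) / (- b + 1)))) UNIV"
    by (simp only: has_integral_restrict_UNIV)
  moreover have "(\<lambda>x. if x \<in> {0..2} then 2 powr b * x powr - b else (0::real)) \<in> borel_measurable borel"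
    by measurable
  ultimately have "integral\<^sup>N lborel (\<lambda>x. ennreal (if x \<in> {0..2} then 2 powr b * x powr - b else 0))
      = ennreal (2 powr b * (2 powr (- b + 1) / (- b + 1)))"
    by (intro nn_integral_has_integral_lborel) auto
  moreover have "ennreal ((u / 2) powr - b) * indicator {0..2} u
      = ennreal (if u \<in> {0..2} then 2 powr b * u powr - b else 0)" for u :: real
    by (auto simp: indicator_def powr_divide powr_minus divide_simps)
  ultimately show ?thesis by simp
qed

lemma nn_integral_inverse_powr_finite:
  fixes b :: real
  assumes "b < 1"
  shows "(\<integral>\<^sup>+u. inverse (ennreal ((\<bar>u\<bar> / 2) powr b)) * indicator {- 2..2} u \<partial>lborel) < \<infinity>"
    (is "?I < _")
proof -
  let ?q = "\<lambda>u::real. ennreal ((u / 2) powr - b) * indicator {0..2} u"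
  have "?I \<le> (\<integral>\<^sup>+u. ?q u + ?q (- u) \<partial>lborel)"
  proof (rule nn_integral_mono_AE)
    have "AE u in lborel. u \<noteq> (0::real)" by (rule AE_lborel_singleton)
    then show "AE u in lborel. inverse (ennreal ((\<bar>u\<bar> / 2) powr b)) * indicator {- 2..2} u \<le> ?q u + ?q (- u)"
    proof eventually_elim
      case (elim u)
      then show ?case
        by (cases "u > 0") (auto simp: inverse_ennreal powr_minus split: split_indicator)
    qed
  qed
  also have "\<dots> = integral\<^sup>N lborel ?q + (\<integral>\<^sup>+u. ?q (- u) \<partial>lborel)"
    by (rule nn_integral_add) measurable
  also have "(\<integral>\<^sup>+u. ?q (- u) \<partial>lborel) = integral\<^sup>N lborel ?q"
    using nn_integral_real_affine[of ?q "- 1" 0] by simp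
  also have "integral\<^sup>N lborel ?q + integral\<^sup>N lborel ?q < \<infinity>"
    using nn_integral_powr_from_0_finite[OF assms] by simp
  finally show ?thesis .
qed

text \<open>
  Around each of its zeros \<open>-2 \<pi>, -\<pi>, 0, \<pi>, 2 \<pi>\<close>, the sine is bounded below by half the distance to
  that zero. The interval is \<open>{- (2 * pi)..2 * pi}\<close> rather than one period so that it contains
  \<open>t - \<psi>\<close> for all angles \<open>t\<close> and \<open>\<psi>\<close> in \<open>{0..<2 * pi}\<close>.
\<close>
lemma nn_integral_sin_kernel_finite:
  fixes b :: real
  assumes "0 \<le> b" "b < 1"
  shows "(\<integral>\<^sup>+t. sin_kernel b t * indicator {- (2 * pi)..2 * pi} t \<partial>lborel) < \<infinity>"
    (is "?I < _")
proof -
  let ?q = "\<lambda>u::real. inverse (ennreal ((\<bar>u\<bar> / 2) powr b)) * indicator {- 2..2} u"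
  have "?I \<le> (\<integral>\<^sup>+t. (\<Sum>j\<in>{-2..2::int}. ?q (- of_int j * pi + 1 * t)) \<partial>lborel)"
  proof (rule nn_integral_mono)
    fix t :: real
    show "sin_kernel b t * indicator {- (2 * pi)..2 * pi} t \<le> (\<Sum>j\<in>{-2..2::int}. ?q (- of_int j * pi + 1 * t))"
    proof (cases "t \<in> {- (2 * pi)..2 * pi}")
      case True
      \<comment> \<open>\<open>j * pi\<close> is the zero of the sine nearest to \<open>t\<close>, and \<open>u\<close> is the offset from it.\<close>
      define j :: int where "j = round (t / pi)"
      define u where "u = - of_int j * pi + 1 * t"
      have "\<bar>of_int j - t / pi\<bar> \<le> 1 / 2" unfolding j_def by (rule of_int_round_abs_le)
      then have "\<bar>of_int j - t / pi\<bar> * pi \<le> 1 / 2 * pi" by (intro mult_right_mono) auto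
      moreover have "\<bar>of_int j - t / pi\<bar> * pi = \<bar>(of_int j - t / pi) * pi\<bar>" by (simp add: abs_mult)
      moreover have "(of_int j - t / pi) * pi = - u" by (simp add: u_def field_simps)
      ultimately have u: "\<bar>u\<bar> \<le> pi / 2" by simp
      have "- 2 \<le> t / pi" "t / pi \<le> 2" using True by (auto simp: field_simps)
      then have "round (- 2 :: real) \<le> j" "j \<le> round (2 :: real)"
        unfolding j_def by (intro round_mono; simp)+
      then have j: "j \<in> {-2..2}" by simp
      have "sin t = sin (u + pi * of_int j)" by (simp add: u_def algebra_simps)
      also have "\<bar>\<dots>\<bar> = \<bar>sin u\<bar>"
        by (simp add: sin_add sin_npi_int cos_npi_int)
      finally have "\<bar>sin t\<bar> = \<bar>sin u\<bar>" .
      then have "\<bar>u\<bar> / 2 \<le> \<bar>sin t\<bar>" using half_le_abs_sin[OF u] by simp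
      then have "(\<bar>u\<bar> / 2) powr b \<le> \<bar>sin t\<bar> powr b" using assms by (intro powr_mono2) auto
      then have "sin_kernel b t \<le> inverse (ennreal ((\<bar>u\<bar> / 2) powr b))"
        unfolding sin_kernel_def by (intro inverse_ennreal_antimono) (auto intro: ennreal_leI)
      moreover have "u \<in> {- 2..2}" using u pi_less_4 by auto
      ultimately have "sin_kernel b t * indicator {- (2 * pi)..2 * pi} t \<le> ?q u" using True by simp
      also have "\<dots> \<le> (\<Sum>j\<in>{-2..2::int}. ?q (- of_int j * pi + 1 * t))"
        unfolding u_def by (rule member_le_sum[OF j]) auto
      finally show ?thesis .
    qed simp
  qed
  also have "\<dots> = (\<Sum>j\<in>{-2..2::int}. (\<integral>\<^sup>+t. ?q (- of_int j * pi + 1 * t) \<partial>lborel))"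
    by (rule nn_integral_sum) measurable
  also have "\<dots> = (\<Sum>j\<in>{-2..2::int}. integral\<^sup>N lborel ?q)"
  proof (rule sum.cong[OF refl])
    fix j :: int
    have [measurable]: "?q \<in> borel_measurable borel" by measurable
    show "(\<integral>\<^sup>+t. ?q (- of_int j * pi + 1 * t) \<partial>lborel) = integral\<^sup>N lborel ?q"
      using nn_integral_real_affine[of ?q 1 "- of_int j * pi"] by simp
  qed
  also have "\<dots> < \<infinity>"
    using nn_integral_inverse_powr_finite[OF assms(2)] by (simp add: ennreal_mult_less_top less_top)
  finally show ?thesis .
qed

text \<open>
  The first summand is bounded and continuous in \<open>t\<close>, and equals the kernel where \<open>\<epsilon> \<le> \<bar>sin t\<bar>\<close>. The
  second dominates the kernel where \<open>\<bar>sin t\<bar> < \<epsilon>\<close>; there, paying with the larger exponent \<open>b\<close> gains a factor that tends to \<open>0\<close> with \<open>\<epsilon>\<close>.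
\<close>
lemma sin_kernel_split:
  fixes a b \<epsilon> t :: real
  assumes "0 < a" "a < b" "0 < \<epsilon>"
  shows "sin_kernel a t \<le> ennreal (max \<bar>sin t\<bar> \<epsilon> powr - a) + ennreal (\<epsilon> powr (b - a)) * sin_kernel b t"
proof -
  consider "sin t = 0" | "\<epsilon> \<le> \<bar>sin t\<bar>" "sin t \<noteq> 0" | "0 < \<bar>sin t\<bar>" "\<bar>sin t\<bar> < \<epsilon>" by fastforce
  then show ?thesis
  proof cases
    case 1
    then show ?thesis using assms by (simp add: sin_kernel_def ennreal_mult_top)
  next
    case 2
    then have "sin_kernel a t = ennreal (max \<bar>sin t\<bar> \<epsilon> powr - a)"
      by (simp add: sin_kernel_def inverse_ennreal powr_minus max_def)
    then show ?thesis by simp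
  next
    case 3
    let ?s = "\<bar>sin t\<bar>"
    have "inverse (?s powr a) = ?s powr (b - a) * inverse (?s powr b)"
      using 3 by (simp add: powr_minus[symmetric] powr_add[symmetric])
    also have "\<dots> \<le> \<epsilon> powr (b - a) * inverse (?s powr b)"
      using 3 assms by (intro mult_right_mono powr_mono2) auto
    finally have "sin_kernel a t \<le> ennreal (\<epsilon> powr (b - a)) * sin_kernel b t"
      using 3 by (simp add: sin_kernel_def inverse_ennreal ennreal_mult[symmetric] ennreal_leI)
    then show ?thesis by (simp add: add_increasing)
  qed
qed

lemma max_powr_le_sin_kernel:
  assumes "0 \<le> a" "0 < \<epsilon>"
  shows "ennreal (max \<bar>sin t\<bar> \<epsilon> powr - a) \<le> sin_kernel a t"
proof (cases "sin t = 0 ")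
  case True
  then show ?thesis by (simp add: sin_kernel_def)
next
  case False
  then have "max \<bar>sin t\<bar> \<epsilon> powr - a \<le> \<bar>sin t\<bar> powr - a"
    using assms by (intro powr_mono2') auto
  then show ?thesis using False by (simp add: sin_kernel_def inverse_ennreal powr_minus ennreal_leI)
qed

lemma nn_integral_shift_le:
  fixes f :: "real \<Rightarrow> ennreal"
  assumes [measurable]: "f \<in> borel_measurable borel" and \<psi>: "0 \<le> \<psi>" "\<psi> < T"
  shows "(\<integral>\<^sup>+t. f (t - \<psi>) * indicator {0..<T} t \<partial>lborel) \<le> (\<integral>\<^sup>+t. f t * indicator {- T..T} t \<partial>lborel)"
proof -
  have "(\<integral>\<^sup>+t. f t * indicator {- T..T} t \<partial>lborel)
      = (\<integral>\<^sup>+t. f (- \<psi> + 1 * t) * indicator {- T..T} (- \<psi> + 1 * t) \<partial>lborel)"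
    using nn_integral_real_affine[of "\<lambda>t. f t * indicator {- T..T} t" 1 "- \<psi>"] by simp
  moreover have "(\<integral>\<^sup>+t. f (t - \<psi>) * indicator {0..<T} t \<partial>lborel) \<le> \<dots>"
    using \<psi> by (intro nn_integral_mono) (auto split: split_indicator)
  ultimately show ?thesis by simp
qed

section \<open>Equidistributed sets\<close>

lemma nn_integral_cells:
  fixes f :: "real \<Rightarrow> ennreal"
  assumes [measurable]: "f \<in> borel_measurable borel" and "0 < L"
  shows "(\<integral>\<^sup>+t. f t * indicator {0..<real N * L} t \<partial>lborel)
     = (\<Sum>j<N. \<integral>\<^sup>+t. f t * indicator {real j * L..<real (Suc j) * L} t \<partial>lborel)"
proof (induction N)
  case (Suc N)
  have "real N * L \<ge> 0" "real N * L \<le> real (Suc N) * L" using assms by auto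
  then have "f t * indicator {0..<real (Suc N) * L} t
      = f t * indicator {0..<real N * L} t + f t * indicator {real N * L..<real (Suc N) * L} t" for t
    by (auto split: split_indicator)
  then show ?case by (simp add: nn_integral_add Suc.IH del: of_nat_Suc)
qed simp

text \<open>
  The line is cut into the cells \<open>[j L, (j + 1) L)\<close>, and the set consists of the initial \<open>n\<close>-th part of
  each cell.
\<close>
definition cell_starts :: "real \<Rightarrow> nat \<Rightarrow> real set" where
  "cell_starts L n = {t. frac (t / L) < 1 / real n}"

lemma cell_starts_measurable [measurable]: "cell_starts L n \<in> sets borel"
  unfolding cell_starts_def frac_def by measurable

lemma cell_starts_in_cell:
  assumes "0 < L" "0 < n"
  shows "cell_starts L n \<inter> {real j * L..<real (Suc j) * L} = {real j * L..<real j * L + L / real n}"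
proof -
  have le: "L / real n \<le> L" using assms by (simp add: field_simps)
  have *: "t \<in> cell_starts L n \<longleftrightarrow> t < real j * L + L / real n" if "t \<in> {real j * L..<real (Suc j) * L}" for t
  proof -
    have "real j \<le> t / L" "t / L < real j + 1" using that assms by (auto simp: field_simps)
    then have "\<lfloor>t / L\<rfloor> = int j" by (intro floor_unique) auto
    then show ?thesis using assms by (auto simp: cell_starts_def frac_def field_simps)
  qed
  have "real j * L + L / real n \<le> real (Suc j) * L" using le by (simp add: algebra_simps)
  then show ?thesis using * by fastforce
qed

lemma nn_integral_cell_starts:
  assumes "0 < L" "0 < n"
  shows "of_nat n * (\<integral>\<^sup>+t. indicator (cell_starts L n) t * indicator {0..<real N * L} t \<partial>lborel)
    = ennreal (real N * L)"
proof -
  have "(\<integral>\<^sup>+t. indicator (cell_starts L n) t * indicator {real j * L..<real (Suc j) * L} t \<partial>lborel)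
      = ennreal (L / real n)" for j
  proof -
    have "(\<integral>\<^sup>+t. indicator (cell_starts L n) t * indicator {real j * L..<real (Suc j) * L} t \<partial>lborel)
      = (\<integral>\<^sup>+t. indicator {real j * L..<real j * L + L / real n} t \<partial>lborel)"
      unfolding cell_starts_in_cell[OF assms, symmetric] by (simp add: indicator_inter_arith)
    also have "\<dots> = ennreal (L / real n)" using assms by simp
    finally show ?thesis .
  qed
  then have "(\<integral>\<^sup>+t. indicator (cell_starts L n) t * indicator {0..<real N * L} t \<partial>lborel)
    = of_nat N * ennreal (L / real n)"
    using assms by (subst nn_integral_cells) auto
  then show ?thesis
    using assms by (simp add: ennreal_of_nat_eq_real_of_nat ennreal_mult[symmetric])
qed

text \<open>
  If \<open>g\<close> varies by at most \<open>1\<close> over a cell, then for each \<open>s\<close> in the cell, \<open>n\<close> times the integral of \<open>g\<close>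
  over its initial \<open>n\<close>-th part is at most \<open>L (g s + 1)\<close>. Averaging over \<open>s\<close> in the cell and
  summing over the cells gives the bound.
\<close>
lemma nn_integral_cell_starts_le:
  fixes g :: "real \<Rightarrow> real"
  assumes [measurable]: "g \<in> borel_measurable borel" and "0 < L" "0 < n"
    and osc: "\<And>s t. \<bar>s - t\<bar> \<le> L \<Longrightarrow> g s \<le> g t + 1"
    and nonneg: "\<And>t. 0 \<le> g t"
  shows "of_nat n * (\<integral>\<^sup>+t. ennreal (g t) * indicator (cell_starts L n) t * indicator {0..<real N * L} t \<partial>lborel)
     \<le> (\<integral>\<^sup>+t. ennreal (g t + 1) * indicator {0..<real N * L} t \<partial>lborel)"
proof -
  have cell: "of_nat n * (\<integral>\<^sup>+t. ennreal (g t) * indicator (cell_starts L n) t * indicator {real j * L..<real (Suc j) * L} t \<partial>lborel)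
    \<le> (\<integral>\<^sup>+t. ennreal (g t + 1) * indicator {real j * L..<real (Suc j) * L} t \<partial>lborel)"
    (is "of_nat n * ?A \<le> ?B") for j
  proof -
    let ?I = "{real j * L..<real (Suc j) * L}"
    let ?J = "{real j * L..<real j * L + L / real n}"
    have len: "(\<integral>\<^sup>+s. indicator ?I s \<partial>lborel) = ennreal L" using \<open>0 < L\<close> by (simp add: algebra_simps)
    have A: "?A = (\<integral>\<^sup>+t. ennreal (g t) * indicator ?J t \<partial>lborel)"
      unfolding cell_starts_in_cell[OF assms(2,3), symmetric] by (simp add: indicator_inter_arith mult.assoc)
    have pt: "of_nat n * ?A \<le> ennreal L * ennreal (g s + 1)" if s: "s \<in> ?I" for s
    proof -
      have "?A \<le> (\<integral>\<^sup>+t. ennreal (g s + 1) * indicator ?J t \<partial>lborel)" unfolding A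
      proof (rule nn_integral_mono)
        fix t
        show "ennreal (g t) * indicator ?J t \<le> ennreal (g s + 1) * indicator ?J t"
        proof (cases "t \<in> ?J")
          case True
          have "L / real n \<le> L" using assms by (simp add: field_simps)
          then have "\<bar>t - s\<bar> \<le> L" using True s by (auto simp: algebra_simps)
          then show ?thesis using True osc by (simp add: ennreal_leI)
        qed simp
      qed
      also have "\<dots> = ennreal (g s + 1) * ennreal (L / real n)"
        using assms by (simp add: nn_integral_cmult)
      finally have "of_nat n * ?A \<le> of_nat n * (ennreal (g s + 1) * ennreal (L / real n))"
        by (rule mult_left_mono) simp
      also have "\<dots> = ennreal (real n * ((g s + 1) * (L / real n)))"
        using assms nonneg[of s] by (simp add: ennreal_of_nat_eq_real_of_nat ennreal_mult[symmetric] del: ennreal_plus)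
      also have "\<dots> = ennreal L * ennreal (g s + 1)"
        using assms nonneg[of s] by (simp add: ennreal_mult[symmetric] mult.commute del: ennreal_plus)
      finally show ?thesis .
    qed
    have "ennreal L * (of_nat n * ?A) = (\<integral>\<^sup>+s. (of_nat n * ?A) * indicator ?I s \<partial>lborel)"
      unfolding len[symmetric] by (subst nn_integral_cmult) (auto simp: mult.commute)
    also have "\<dots> \<le> (\<integral>\<^sup>+s. ennreal L * (ennreal (g s + 1) * indicator ?I s) \<partial>lborel)"
      using pt by (intro nn_integral_mono) (auto split: split_indicator)
    also have "\<dots> = ennreal L * ?B" by (rule nn_integral_cmult) measurable
    finally show ?thesis using \<open>0 < L\<close> by (subst (asm) ennreal_mult_le_mult_iff) auto
  qed
  show ?thesis
    using assms(2)
    by (subst (1 2) nn_integral_cells) (auto simp: sum_distrib_left simp del: of_nat_Suc intro!: sum_mono cell)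
qed


text \<open>
  The function \<open>x \<mapsto> (max \<bar>x\<bar> \<epsilon>)\<^sup>-\<^sup>a\<close> is uniformly continuous on \<open>[-1, 1]\<close>, and the sine is
  1-Lipschitz.
\<close>
lemma max_sin_powr_uniform_oscillation:
  fixes a \<epsilon> :: real
  assumes "0 < \<epsilon>"
  obtains \<delta> where "0 < \<delta>"
    "\<And>s t. \<bar>s - t\<bar> < \<delta> \<Longrightarrow> max \<bar>sin s\<bar> \<epsilon> powr - a \<le> max \<bar>sin t\<bar> \<epsilon> powr - a + 1"
proof -
  have "continuous_on {- 1..1} (\<lambda>x. max \<bar>x\<bar> \<epsilon> powr - a)"
    using assms by (intro continuous_intros) auto
  then have "uniformly_continuous_on {- 1..1} (\<lambda>x. max \<bar>x\<bar> \<epsilon> powr - a)"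
    by (rule compact_uniformly_continuous) auto
  then obtain \<delta> where "0 < \<delta>"
    and \<delta>: "\<And>x x'. x \<in> {- 1..1} \<Longrightarrow> x' \<in> {- 1..1} \<Longrightarrow> dist x' x < \<delta> \<Longrightarrow>
      dist (max \<bar>x'\<bar> \<epsilon> powr - a) (max \<bar>x\<bar> \<epsilon> powr - a) < 1"
    unfolding uniformly_continuous_on_def by (metis zero_less_one)
  show thesis
  proof (rule that[OF \<open>0 < \<delta>\<close>])
    fix s t :: real
    assume "\<bar>s - t\<bar> < \<delta>"
    moreover have "\<bar>sin s - sin t\<bar> \<le> \<bar>s - t\<bar>"
      using abs_sin_x_le_abs_x[of "(s - t) / 2"] mult_mono[OF _ abs_cos_le_one[of "(s + t) / 2"], of "\<bar>sin ((s - t) / 2)\<bar>" "\<bar>s - t\<bar> / 2"]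
      by (simp add: sin_diff_sin abs_mult)
    ultimately have "\<bar>max \<bar>sin s\<bar> \<epsilon> powr - a - max \<bar>sin t\<bar> \<epsilon> powr - a\<bar> < 1"
      using \<delta>[of "sin t" "sin s"] by (simp add: dist_real_def)
    then show "max \<bar>sin s\<bar> \<epsilon> powr - a \<le> max \<bar>sin t\<bar> \<epsilon> powr - a + 1" by linarith
  qed
qed

text \<open>
  The bound does not depend on \<open>n\<close>: the cell length \<open>L\<close> is chosen after \<open>n\<close>. The truncated
  kernel contributes the integral of the kernel plus the length \<open>2 \<pi>\<close> of the interval, because of the
  error \<open>1\<close> allowed on each cell, and the singular remainder contributes at most \<open>1\<close>.
\<close>
lemma cell_starts_potential_bounded:
  fixes a :: real
  assumes "0 < a" "a < 1" "0 < n"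
  obtains L where "0 < L"
    "of_nat n * (\<integral>\<^sup>+t. indicator (cell_starts L n) t * indicator {0..<2 * pi} t \<partial>lborel) = ennreal (2 * pi)"
    "\<And>\<psi>. 0 \<le> \<psi> \<Longrightarrow> \<psi> < 2 * pi \<Longrightarrow>
      of_nat n * (\<integral>\<^sup>+t. sin_kernel a (t - \<psi>) * indicator (cell_starts L n) t * indicator {0..<2 * pi} t \<partial>lborel)
      \<le> (\<integral>\<^sup>+t. sin_kernel a t * indicator {- (2 * pi)..2 * pi} t \<partial>lborel) + ennreal (2 * pi) + 1"
proof -
  define b where "b = (1 + a) / 2"
  have b: "a < b" "b < 1" using assms by (auto simp: b_def)
  let ?D = "\<lambda>b. \<integral>\<^sup>+t. sin_kernel b t * indicator {- (2 * pi)..2 * pi} t \<partial>lborel"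
  define d where "d = enn2real (?D b)"
  have d: "?D b = ennreal d" "0 \<le> d"
    using nn_integral_sin_kernel_finite[of b] b assms by (auto simp: d_def less_top)
  \<comment> \<open>Chosen so that \<open>n\<close> times the integral \<open>\<epsilon> powr (b - a) * d\<close> of the singular remainder is at most \<open>1\<close>.\<close>
  define \<epsilon> where "\<epsilon> = (1 / (real n * d + 1)) powr (1 / (b - a))"
  have nd: "0 < real n * d + 1" using d by (simp add: add_nonneg_pos)
  then have \<epsilon>: "0 < \<epsilon>" by (simp add: \<epsilon>_def)
  have "\<epsilon> powr (b - a) = 1 / (real n * d + 1)" using b nd by (simp add: \<epsilon>_def powr_powr)
  then have small: "real n * (\<epsilon> powr (b - a) * d) \<le> 1" using nd by simp
  obtain \<delta> where \<delta>: "0 < \<delta>"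
    "\<And>s t. \<bar>s - t\<bar> < \<delta> \<Longrightarrow> max \<bar>sin s\<bar> \<epsilon> powr - a \<le> max \<bar>sin t\<bar> \<epsilon> powr - a + 1"
    using max_sin_powr_uniform_oscillation[OF \<epsilon>, of a] by blast
  obtain N :: nat where N: "2 * pi / \<delta> < real N" using reals_Archimedean2 by blast
  then have "0 < real N" using \<delta>(1) by (meson divide_pos_pos less_trans mult_pos_pos pi_gt_zero zero_less_numeral)
  define L where "L = 2 * pi / real N"
  have L: "0 < L" "L < \<delta>" "real N * L = 2 * pi"
    using N \<delta>(1) \<open>0 < real N\<close> by (auto simp: L_def field_simps)
  show thesis
  proof (rule that[OF L(1)])
    show "of_nat n * (\<integral>\<^sup>+t. indicator (cell_starts L n) t * indicator {0..<2 * pi} t \<partial>lborel) = ennreal (2 * pi)"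
      using nn_integral_cell_starts[OF L(1) assms(3), of N] L(3) by simp
  next
    fix \<psi> :: real
    assume \<psi>: "0 \<le> \<psi>" "\<psi> < 2 * pi"
    let ?g = "\<lambda>t. max \<bar>sin (t - \<psi>)\<bar> \<epsilon> powr - a"
    let ?P = "indicator {0..<2 * pi} :: real \<Rightarrow> ennreal"
    let ?E = "indicator (cell_starts L n) :: real \<Rightarrow> ennreal"
    have "(\<integral>\<^sup>+t. sin_kernel a (t - \<psi>) * ?E t * ?P t \<partial>lborel)
      \<le> (\<integral>\<^sup>+t. ennreal (?g t) * ?E t * ?P t + ennreal (\<epsilon> powr (b - a)) * (sin_kernel b (t - \<psi>) * ?P t) \<partial>lborel)"
      using sin_kernel_split[OF assms(1) b(1) \<epsilon>] by (intro nn_integral_mono) (auto split: split_indicator)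
    also have "\<dots> = (\<integral>\<^sup>+t. ennreal (?g t) * ?E t * ?P t \<partial>lborel)
        + ennreal (\<epsilon> powr (b - a)) * (\<integral>\<^sup>+t. sin_kernel b (t - \<psi>) * ?P t \<partial>lborel)"
      by (simp add: nn_integral_add nn_integral_cmult)
    also have "\<dots> \<le> (\<integral>\<^sup>+t. ennreal (?g t) * ?E t * ?P t \<partial>lborel) + ennreal (\<epsilon> powr (b - a)) * ?D b"
      using nn_integral_shift_le[of "sin_kernel b" \<psi> "2 * pi"] \<psi> by (intro add_left_mono mult_left_mono) auto
    finally have "of_nat n * (\<integral>\<^sup>+t. sin_kernel a (t - \<psi>) * ?E t * ?P t \<partial>lborel)
      \<le> of_nat n * ((\<integral>\<^sup>+t. ennreal (?g t) * ?E t * ?P t \<partial>lborel) + ennreal (\<epsilon> powr (b - a)) * ?D b)"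
      by (rule mult_left_mono) simp
    also have "\<dots> = of_nat n * (\<integral>\<^sup>+t. ennreal (?g t) * ?E t * ?P t \<partial>lborel) + ennreal (real n * (\<epsilon> powr (b - a) * d))"
      using d by (simp add: distrib_left ennreal_of_nat_eq_real_of_nat ennreal_mult)
    finally have split: "of_nat n * (\<integral>\<^sup>+t. sin_kernel a (t - \<psi>) * ?E t * ?P t \<partial>lborel)
      \<le> of_nat n * (\<integral>\<^sup>+t. ennreal (?g t) * ?E t * ?P t \<partial>lborel) + ennreal (real n * (\<epsilon> powr (b - a) * d))" .
    have "of_nat n * (\<integral>\<^sup>+t. ennreal (?g t) * ?E t * ?P t \<partial>lborel) \<le> (\<integral>\<^sup>+t. ennreal (?g t + 1) * ?P t \<partial>lborel)"
      unfolding L(3)[symmetric]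
    proof (rule nn_integral_cell_starts_le[OF _ L(1) assms(3)])
      show "?g s \<le> ?g t + 1" if "\<bar>s - t\<bar> \<le> L" for s t
        using \<delta>(2)[of "s - \<psi>" "t - \<psi>"] that L(2) by simp
    qed auto
    also have "\<dots> \<le> (\<integral>\<^sup>+t. sin_kernel a (t - \<psi>) * ?P t + ?P t \<partial>lborel)"
      using max_powr_le_sin_kernel[of a \<epsilon>] assms \<epsilon> by (intro nn_integral_mono) (auto split: split_indicator)
    also have "\<dots> = (\<integral>\<^sup>+t. sin_kernel a (t - \<psi>) * ?P t \<partial>lborel) + ennreal (2 * pi)"
      by (simp add: nn_integral_add)
    also have "\<dots> \<le> ?D a + ennreal (2 * pi)"
      using nn_integral_shift_le[of "sin_kernel a" \<psi> "2 * pi"] \<psi> by (intro add_right_mono) auto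
    finally have regular: "of_nat n * (\<integral>\<^sup>+t. ennreal (?g t) * ?E t * ?P t \<partial>lborel) \<le> ?D a + ennreal (2 * pi)" .
    have "ennreal (real n * (\<epsilon> powr (b - a) * d)) \<le> 1"
      using small by simp
    with regular have "of_nat n * (\<integral>\<^sup>+t. ennreal (?g t) * ?E t * ?P t \<partial>lborel) + ennreal (real n * (\<epsilon> powr (b - a) * d))
      \<le> ?D a + ennreal (2 * pi) + 1"
      by (rule add_mono)
    with split show "of_nat n * (\<integral>\<^sup>+t. sin_kernel a (t - \<psi>) * ?E t * ?P t \<partial>lborel) \<le> ?D a + ennreal (2 * pi) + 1"
      by (rule order_trans)
  qed
qed

section \<open>Transfer to the circle\<close>

lemma sets_arc_length: "sets arc_length = sets (restrict_space borel circle)"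
  by (simp add: arc_length_def)

lemma nn_integral_arc_length:
  assumes "f \<in> borel_measurable arc_length"
  shows "(\<integral>\<^sup>+\<theta>. f \<theta> \<partial>arc_length) = (\<integral>\<^sup>+t. f (circle_point t) * indicator {0..<2 * pi} t \<partial>lborel)"
proof -
  have "f \<in> borel_measurable (restrict_space borel circle)"
    using assms by (simp add: measurable_cong_sets[OF sets_arc_length])
  then show ?thesis
    unfolding arc_length_def
    by (simp add: nn_integral_distr[OF measurable_circle_point] nn_integral_restrict_space)
qed

lemma borel_measurable_arc_length:
  "f \<in> borel_measurable borel \<Longrightarrow> f \<in> borel_measurable arc_length"
  by (simp add: measurable_cong_sets[OF sets_arc_length] measurable_restrict_space1)

lemma circle_point_components [simp]: "circle_point t $ 1 = cos t" "circle_point t $ 2 = sin t"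
  by (simp_all add: circle_point_def)

lemma circle_inner_eq_sin_diff:
  assumes "\<xi> \<in> circle"
  obtains \<psi> where "0 \<le> \<psi>" "\<psi> < 2 * pi" "\<And>t. circle_point t \<bullet> \<xi> = sin (t - \<psi>)"
proof -
  have "(\<xi> $ 2)\<^sup>2 + (- \<xi> $ 1)\<^sup>2 = 1"
    using assms by (simp add: norm_eq_1 inner_vec_def sum_2 power2_eq_square)
  then obtain \<psi> where "0 \<le> \<psi>" "\<psi> < 2 * pi" "\<xi> $ 2 = cos \<psi>" "- \<xi> $ 1 = sin \<psi>"
    by (rule sincos_total_2pi)
  note \<psi> = this
  have "\<xi> $ 1 = - sin \<psi>" using \<psi>(4) by simp
  then have "circle_point t \<bullet> \<xi> = sin (t - \<psi>)" for t
    by (simp add: inner_vec_def sum_2 sin_diff \<psi>(3))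
  with \<psi>(1,2) show thesis by (rule that)
qed

definition circle_angle :: "real ^ 2 \<Rightarrow> real" where
  "circle_angle \<theta> = (if 0 \<le> \<theta> $ 2 then arccos (\<theta> $ 1) else 2 * pi - arccos (\<theta> $ 1))"

lemma circle_angle_circle_point:
  assumes "0 \<le> t" "t < 2 * pi"
  shows "circle_angle (circle_point t) = t"
proof (cases "t \<le> pi")
  case True
  then show ?thesis using assms sin_ge_zero by (simp add: circle_angle_def arccos_cos)
next
  case False
  then have "arccos (cos t) = arccos (cos (2 * pi - t))" by simp
  also have "\<dots> = 2 * pi - t" using False assms by (intro arccos_cos) auto
  finally show ?thesis using False assms sin_lt_zero[of t] by (simp add: circle_angle_def)
qed

lemma measurable_circle_angle: "circle_angle \<in> borel_measurable arc_length"
proof -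
  have "continuous_on circle (\<lambda>\<theta> :: real ^ 2. arccos (\<theta> $ 1))"
  proof (rule continuous_on_arccos)
    show "\<forall>\<theta>\<in>circle. - 1 \<le> (\<theta> :: real ^ 2) $ 1 \<and> \<theta> $ 1 \<le> 1"
    proof
      fix \<theta> :: "real ^ 2"
      assume "\<theta> \<in> circle"
      then show "- 1 \<le> \<theta> $ 1 \<and> \<theta> $ 1 \<le> 1"
        using component_le_norm_cart[of \<theta> 1] by (auto simp: abs_le_iff)
    qed
  qed (intro continuous_intros)
  then have [measurable]: "(\<lambda>\<theta> :: real ^ 2. arccos (\<theta> $ 1)) \<in> borel_measurable (restrict_space borel circle)"
    by (rule borel_measurable_continuous_on_restrict)
  have [measurable]: "(\<lambda>\<theta> :: real ^ 2. \<theta> $ 2) \<in> borel_measurable (restrict_space borel circle)"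
    by (intro measurable_restrict_space1 borel_measurable_continuous_onI continuous_intros)
  have "circle_angle \<in> borel_measurable (restrict_space borel circle)"
    unfolding circle_angle_def by measurable
  then show ?thesis by (simp add: measurable_cong_sets[OF sets_arc_length])
qed

text \<open>
  The indicator of such a set, normalized to have the mass of the constant function \<open>1\<close>, has norm at most
  \<open>C\<close>.
\<close>
definition evenly_spread :: "real \<Rightarrow> ennreal \<Rightarrow> nat \<Rightarrow> (real ^ 2) set \<Rightarrow> bool" where
  "evenly_spread a C n A \<longleftrightarrow> A \<in> sets arc_length \<and> of_nat n * emeasure arc_length A = ennreal (2 * pi) \<and>
    (\<forall>\<xi>\<in>circle. of_nat n * (\<integral>\<^sup>+\<theta>. indicator A \<theta> * inverse (ennreal (\<bar>\<theta> \<bullet> \<xi>\<bar> powr a)) \<partial>arc_length) \<le> C)"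

lemma exists_evenly_spread:
  fixes a :: real
  assumes "0 < a" "a < 1"
  shows "\<exists>C<\<infinity>. \<forall>n>0. \<exists>A. evenly_spread a C n A"
proof -
  define C where "C = (\<integral>\<^sup>+t. sin_kernel a t * indicator {- (2 * pi)..2 * pi} t \<partial>lborel) + ennreal (2 * pi) + 1"
  have "C < \<infinity>" using nn_integral_sin_kernel_finite[of a] assms by (simp add: C_def)
  moreover have "\<exists>A. evenly_spread a C n A" if "0 < n" for n
  proof -
    obtain L where "0 < L" and L:
      "of_nat n * (\<integral>\<^sup>+t. indicator (cell_starts L n) t * indicator {0..<2 * pi} t \<partial>lborel) = ennreal (2 * pi)"
      "\<And>\<psi>. 0 \<le> \<psi> \<Longrightarrow> \<psi> < 2 * pi \<Longrightarrow>
        of_nat n * (\<integral>\<^sup>+t. sin_kernel a (t - \<psi>) * indicator (cell_starts L n) t * indicator {0..<2 * pi} t \<partial>lborel) \<le> C"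
      using that unfolding C_def by (rule cell_starts_potential_bounded[OF assms \<open>0 < n\<close>])
    define A where "A = circle_angle -` cell_starts L n \<inter> space arc_length"
    have A [measurable]: "A \<in> sets arc_length"
      unfolding A_def using measurable_circle_angle by (rule measurable_sets) measurable
    have ind: "indicator A (circle_point t) * indicator {0..<2 * pi} t
        = (indicator (cell_starts L n) t * indicator {0..<2 * pi} t :: ennreal)" for t
      using circle_point_in_circle[of t] circle_angle_circle_point[of t]
      by (auto simp: A_def space_arc_length indicator_def)
    have "evenly_spread a C n A" unfolding evenly_spread_def
    proof (intro conjI ballI A)
      have "emeasure arc_length A = (\<integral>\<^sup>+\<theta>. indicator A \<theta> \<partial>arc_length)" using A by simp
      also have "\<dots> = (\<integral>\<^sup>+t. indicator (cell_starts L n) t * indicator {0..<2 * pi} t \<partial>lborel)"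
        by (subst nn_integral_arc_length) (auto simp: ind)
      finally show "of_nat n * emeasure arc_length A = ennreal (2 * pi)" using L(1) by simp
    next
      fix \<xi> :: "real ^ 2"
      assume \<xi>: "\<xi> \<in> circle"
      obtain \<psi> where \<psi>: "0 \<le> \<psi>" "\<psi> < 2 * pi" "\<And>t. circle_point t \<bullet> \<xi> = sin (t - \<psi>)"
        using that by (rule circle_inner_eq_sin_diff[OF \<xi>])
      have [measurable]: "(\<lambda>\<theta>. \<bar>\<theta> \<bullet> \<xi>\<bar> powr a) \<in> borel_measurable arc_length"
        by (rule borel_measurable_arc_length) measurable
      have "(\<integral>\<^sup>+\<theta>. indicator A \<theta> * inverse (ennreal (\<bar>\<theta> \<bullet> \<xi>\<bar> powr a)) \<partial>arc_length)
        = (\<integral>\<^sup>+t. sin_kernel a (t - \<psi>) * (indicator A (circle_point t) * indicator {0..<2 * pi} t) \<partial>lborel)"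
        by (subst nn_integral_arc_length) (auto simp: \<psi>(3) sin_kernel_def mult_ac)
      then show "of_nat n * (\<integral>\<^sup>+\<theta>. indicator A \<theta> * inverse (ennreal (\<bar>\<theta> \<bullet> \<xi>\<bar> powr a)) \<partial>arc_length) \<le> C"
        using L(2)[OF \<psi>(1,2)] by (simp add: ind mult.assoc)
    qed
    then show ?thesis by blast
  qed
  ultimately show ?thesis by blast
qed

section \<open>A finite norm outside the Orlicz class\<close>


lemma ennreal_eq_infinity_if_of_nat_le:
  fixes x :: ennreal
  assumes "\<And>m::nat. of_nat m \<le> x"
  shows "x = \<infinity>"
proof -
  have "(SUP m::nat. of_nat m) \<le> x" using assms by (rule SUP_least)
  then show ?thesis by (simp add: ennreal_SUP_of_nat_eq_top top_unique)
qed

text \<open>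
  Applied with \<open>W = 1\<close> this bounds the mass of the superposition, and with \<open>W\<close> the kernel at \<open>\<xi>\<close> it
  bounds the supremum defining the norm.
\<close>
lemma nn_integral_geometric_superposition_le:
  fixes A :: "nat \<Rightarrow> 'a set" and n :: "nat \<Rightarrow> nat" and W :: "'a \<Rightarrow> ennreal"
  assumes [measurable]: "\<And>m. A m \<in> sets M" "W \<in> borel_measurable M"
    and bound: "\<And>m. of_nat (n m) * (\<integral>\<^sup>+x. indicator (A m) x * W x \<partial>M) \<le> K"
  shows "(\<integral>\<^sup>+x. (\<Sum>m. ennreal ((1 / 2) ^ m * real (n m)) * indicator (A m) x) * W x \<partial>M) \<le> 2 * K"
proof -
  let ?h = "\<lambda>m. ennreal ((1 / 2) ^ m * real (n m))"
  have "(\<integral>\<^sup>+x. (\<Sum>m. ?h m * indicator (A m) x) * W x \<partial>M)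
      = (\<integral>\<^sup>+x. (\<Sum>m. ?h m * (indicator (A m) x * W x)) \<partial>M)"
    by (simp add: mult.assoc flip: ennreal_suminf_multc)
  also have "\<dots> = (\<Sum>m. ?h m * (\<integral>\<^sup>+x. indicator (A m) x * W x \<partial>M))"
    by (simp add: nn_integral_suminf nn_integral_cmult)
  also have "\<dots> = (\<Sum>m. ennreal ((1 / 2) ^ m) * (of_nat (n m) * (\<integral>\<^sup>+x. indicator (A m) x * W x \<partial>M)))"
    by (simp add: ennreal_mult ennreal_of_nat_eq_real_of_nat mult.assoc)
  also have "\<dots> \<le> (\<Sum>m. ennreal ((1 / 2) ^ m) * K)"
    by (intro suminf_le mult_left_mono bound) auto
  also have "\<dots> = (\<Sum>m. ennreal ((1 / 2) ^ m)) * K" by simp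
  also have "(\<Sum>m. ennreal ((1 / 2) ^ m)) = ennreal 2"
    using geometric_sums[of "1 / 2 :: real"]
    by (intro sums_unique[symmetric]) (simp add: sums_ennreal del: ennreal_numeral)
  finally show ?thesis by simp
qed

lemma exists_nat_ln_powr_ge:
  fixes c y \<alpha> :: real
  assumes "0 < c" "0 < \<alpha>" "0 \<le> y"
  obtains n :: nat where "0 < n" "y \<le> ln (exp 1 + c * real n) powr \<alpha>"
proof -
  define z where "z = y powr (1 / \<alpha>)"
  obtain n :: nat where n: "exp z / c < real n" using reals_Archimedean2 by blast
  then have "0 < n" using assms(1) by (metis divide_pos_pos exp_gt_zero less_trans of_nat_0_less_iff)
  have "exp z < c * real n" using n assms(1) by (simp add: field_simps)
  then have "exp z \<le> exp 1 + c * real n" using exp_gt_zero[of "1 :: real"] by linarith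
  then have "ln (exp z) \<le> ln (exp 1 + c * real n)"
    by (intro ln_mono) (auto intro: less_le_trans[OF exp_gt_zero])
  then have "z powr \<alpha> \<le> ln (exp 1 + c * real n) powr \<alpha>"
    using assms by (intro powr_mono2) (auto simp: z_def)
  moreover have "z powr \<alpha> = y" using assms by (simp add: z_def powr_powr)
  ultimately show thesis using that[OF \<open>0 < n\<close>] by simp
qed

text \<open>
  The sum \<open>G\<close> of the spread functions may be infinite on a null set, where \<open>enn2real\<close> replaces the value by
  \<open>0\<close>. This only decreases the upper bounds, and the lower bound for the logarithmic integral needs
  \<open>\<Omega> \<ge> h m\<close> only almost everywhere on \<open>A m\<close>.
\<close>
lemma K_norm_finite_not_LlogL:
  fixes a \<alpha> :: real
  assumes "0 < a" "a < 1" "0 < \<alpha>"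
  shows "\<exists>\<Omega>. integrable arc_length \<Omega> \<and> K_norm a \<Omega> < \<infinity> \<and> \<Omega> \<notin> LlogL \<alpha>"
proof -
  obtain C where C: "C < \<infinity>" "\<And>n. 0 < n \<Longrightarrow> \<exists>A. evenly_spread a C n A"
    using exists_evenly_spread[OF assms(1,2)] by blast
  \<comment> \<open>The factor \<open>2 ^ m\<close> compensates the weight \<open>(1 / 2) ^ m\<close> of the \<open>m\<close>-th summand, so that its
    logarithmic integral is at least \<open>m\<close>.\<close>
  have "\<exists>n::nat. 0 < n \<and> real m * 2 ^ m \<le> ln (exp 1 + (1 / 2) ^ m * real n) powr \<alpha>" for m :: nat
    by (rule exists_nat_ln_powr_ge[of "(1 / 2) ^ m" \<alpha> "real m * 2 ^ m"]) (use assms(3) in auto)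
  then obtain n :: "nat \<Rightarrow> nat" where n: "\<And>m. 0 < n m"
    "\<And>m. real m * 2 ^ m \<le> ln (exp 1 + (1 / 2) ^ m * real (n m)) powr \<alpha>"
    by metis
  obtain A where "\<And>m. evenly_spread a C (n m) (A m)"
    using C(2)[OF n(1)] by metis
  then have A [measurable]: "\<And>m. A m \<in> sets arc_length"
    and meas: "\<And>m. of_nat (n m) * emeasure arc_length (A m) = ennreal (2 * pi)"
    and pot: "\<And>m \<xi>. \<xi> \<in> circle \<Longrightarrow>
      of_nat (n m) * (\<integral>\<^sup>+\<theta>. indicator (A m) \<theta> * inverse (ennreal (\<bar>\<theta> \<bullet> \<xi>\<bar> powr a)) \<partial>arc_length) \<le> C"
    by (simp_all add: evenly_spread_def)
  define h where "h m = (1 / 2) ^ m * real (n m)" for m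
  have h: "0 \<le> h m" for m by (simp add: h_def)
  define G where "G \<theta> = (\<Sum>m. ennreal (h m) * indicator (A m) \<theta>)" for \<theta>
  have G [measurable]: "G \<in> borel_measurable arc_length" unfolding G_def by measurable
  define \<Omega> where "\<Omega> \<theta> = enn2real (G \<theta>)" for \<theta>
  have \<Omega> [measurable]: "\<Omega> \<in> borel_measurable arc_length" unfolding \<Omega>_def by measurable
  have \<Omega>_le: "ennreal \<bar>\<Omega> \<theta>\<bar> \<le> G \<theta>" for \<theta> by (simp add: \<Omega>_def ennreal_enn2real_if)
  have "(\<integral>\<^sup>+\<theta>. G \<theta> * 1 \<partial>arc_length) \<le> 2 * ennreal (2 * pi)"
    unfolding G_def h_def by (rule nn_integral_geometric_superposition_le) (use meas in auto)
  also have "2 * ennreal (2 * pi) < \<infinity>" by (simp add: ennreal_mult_less_top)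
  finally have G_fin: "integral\<^sup>N arc_length G < \<infinity>" by simp
  have "(\<integral>\<^sup>+\<theta>. ennreal (norm (\<Omega> \<theta>)) \<partial>arc_length) \<le> integral\<^sup>N arc_length G"
    using \<Omega>_le by (intro nn_integral_mono) simp
  then have "integrable arc_length \<Omega>"
    using G_fin by (intro integrableI_bounded) auto
  moreover have "K_norm a \<Omega> < \<infinity>"
  proof -
    have "K_norm a \<Omega> \<le> 2 * C"
      unfolding K_norm_def
    proof (rule SUP_least)
      fix \<xi> :: "real ^ 2"
      assume \<xi>: "\<xi> \<in> circle"
      have [measurable]: "(\<lambda>\<theta>. \<bar>\<theta> \<bullet> \<xi>\<bar> powr a) \<in> borel_measurable arc_length"
        by (rule borel_measurable_arc_length) measurable
      have "(\<integral>\<^sup>+\<theta>. ennreal \<bar>\<Omega> \<theta>\<bar> / ennreal (\<bar>\<theta> \<bullet> \<xi>\<bar> powr a) \<partial>arc_length)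
        \<le> (\<integral>\<^sup>+\<theta>. G \<theta> * inverse (ennreal (\<bar>\<theta> \<bullet> \<xi>\<bar> powr a)) \<partial>arc_length)"
        unfolding divide_ennreal_def using \<Omega>_le by (intro nn_integral_mono mult_right_mono) auto
      also have "\<dots> \<le> 2 * C"
        unfolding G_def h_def by (rule nn_integral_geometric_superposition_le) (use pot[OF \<xi>] in auto)
      finally show "(\<integral>\<^sup>+\<theta>. ennreal \<bar>\<Omega> \<theta>\<bar> / ennreal (\<bar>\<theta> \<bullet> \<xi>\<bar> powr a) \<partial>arc_length) \<le> 2 * C" .
    qed
    also have "2 * C < \<infinity>" using C(1) by (simp add: ennreal_mult_less_top)
    finally show ?thesis .
  qed
  moreover have "\<Omega> \<notin> LlogL \<alpha>"
  proof -
    let ?I = "\<integral>\<^sup>+\<theta>. ennreal (\<bar>\<Omega> \<theta>\<bar> * ln (exp 1 + \<bar>\<Omega> \<theta>\<bar>) powr \<alpha>) \<partial>arc_length"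
    have "of_nat m \<le> ?I" for m :: nat
    proof -
      let ?l = "ln (exp 1 + h m) powr \<alpha>"
      have "AE \<theta> in arc_length. G \<theta> \<noteq> \<infinity>"
        using G_fin by (intro nn_integral_PInf_AE) auto
      then have AE: "AE \<theta> in arc_length. ennreal (h m * ?l) * indicator (A m) \<theta>
          \<le> ennreal (\<bar>\<Omega> \<theta>\<bar> * ln (exp 1 + \<bar>\<Omega> \<theta>\<bar>) powr \<alpha>)"
      proof eventually_elim
        case (elim \<theta>)
        show ?case
        proof (cases "\<theta> \<in> A m")
          case True
          let ?s = "\<lambda>k. ennreal (h k) * indicator (A k) \<theta>"
          have "sum ?s {m} \<le> suminf ?s" by (rule sum_le_suminf) auto
          then have "ennreal (h m) \<le> G \<theta>" using True by (simp add: G_def)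
          also have "G \<theta> = ennreal (\<Omega> \<theta>)" using elim by (simp add: \<Omega>_def ennreal_enn2real_if)
          finally have le: "h m \<le> \<Omega> \<theta>" by (simp add: \<Omega>_def)
          have "1 \<le> exp (1::real)" by simp
          then have "0 \<le> ln (exp 1 + h m)" using h[of m] by (intro ln_ge_zero) linarith
          moreover have "0 < exp 1 + h m" using h[of m] by (simp add: add_pos_nonneg)
          then have "ln (exp 1 + h m) \<le> ln (exp 1 + \<Omega> \<theta>)" using le by (intro ln_mono) auto
          ultimately have "h m * ?l \<le> \<Omega> \<theta> * ln (exp 1 + \<Omega> \<theta>) powr \<alpha>"
            using le h[of m] assms(3) by (intro mult_mono powr_mono2) auto
          then show ?thesis using True h[of m] le by (simp add: ennreal_leI)
        qed simp
      qed
      have "real m \<le> (1 / 2) ^ m * ?l"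
        using n(2)[of m] by (simp add: h_def power_one_over field_simps)
      also have "\<dots> \<le> (1 / 2) ^ m * ?l * (2 * pi)"
        using pi_gt3 mult_left_mono[of 1 "2 * pi" "(1 / 2) ^ m * ?l"] by simp
      finally have "ennreal (real m) \<le> ennreal ((1 / 2) ^ m * ?l * (2 * pi))" by (rule ennreal_leI)
      also have "\<dots> = ennreal ((1 / 2) ^ m * ?l) * ennreal (2 * pi)"
        by (rule ennreal_mult) auto
      also have "\<dots> = ennreal (h m * ?l) * emeasure arc_length (A m)"
        unfolding meas[of m, symmetric]
        by (simp add: h_def ennreal_mult ennreal_of_nat_eq_real_of_nat mult_ac)
      also have "\<dots> = (\<integral>\<^sup>+\<theta>. ennreal (h m * ?l) * indicator (A m) \<theta> \<partial>arc_length)"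
        using A by (simp add: nn_integral_cmult_indicator)
      also have "\<dots> \<le> ?I" using AE by (rule nn_integral_mono_AE)
      finally show ?thesis by (simp add: ennreal_of_nat_eq_real_of_nat)
    qed
    then have "?I = \<infinity>" by (rule ennreal_eq_infinity_if_of_nat_le)
    then show ?thesis by (simp add: LlogL_def)
  qed
  ultimately show ?thesis by blast
qed

section \<open>An infinite norm inside the Orlicz class\<close>

lemma nn_integral_reciprocal_infinite:
  "(\<integral>\<^sup>+t. ennreal (1 / t) * indicator {0<..1::real} t \<partial>lborel) = \<infinity>" (is "?I = _")
proof -
  have "of_nat m \<le> ?I" for m :: nat
  proof -
    let ?x = "exp (- real m)"
    have x: "0 < ?x" "?x \<le> 1" by auto
    have "(\<integral>\<^sup>+t. ennreal (1 / t) * indicator {?x..1} t \<partial>lborel) = ennreal (ln 1 - ln ?x)"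
    proof (rule nn_integral_FTC_Icc)
      fix t :: real
      assume "t \<in> {?x..1}"
      then have "0 < t" using less_le_trans[OF x(1), of t] by simp
      then show "(ln has_real_derivative 1 / t) (at t)" "0 \<le> 1 / t"
        by (auto intro!: derivative_eq_intros)
    qed (use x in auto)
    also have "ln 1 - ln ?x = real m" by simp
    finally have "ennreal (real m) = (\<integral>\<^sup>+t. ennreal (1 / t) * indicator {?x..1} t \<partial>lborel)" by simp
    also have "\<dots> \<le> ?I"
      using less_le_trans[OF x(1)] by (intro nn_integral_mono) (auto split: split_indicator)
    finally show ?thesis by (simp add: ennreal_of_nat_eq_real_of_nat)
  qed
  then show ?thesis by (rule ennreal_eq_infinity_if_of_nat_le)
qed

text \<open>
  A power of the logarithm costs an arbitrarily small power of \<open>x\<close>.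
\<close>
lemma mult_ln_powr_le_powr:
  fixes x q \<alpha> :: real
  assumes "1 \<le> x" "0 < q" "0 < \<alpha>"
  shows "x * ln (exp 1 + x) powr \<alpha> \<le> ((exp 1 + 1) powr q / q) powr \<alpha> * x powr (1 + q * \<alpha>)"
proof -
  have e: "1 \<le> exp (1 :: real)" by simp
  have "ln (exp 1 + x) \<le> (exp 1 + x) powr q / q"
    using assms e by (intro ln_powr_bound) linarith+
  also have "\<dots> \<le> ((exp 1 + 1) * x) powr q / q"
  proof -
    have "exp 1 * 1 \<le> exp 1 * x" using assms by (intro mult_left_mono) auto
    then have "exp 1 + x \<le> (exp 1 + 1) * x" by (simp add: algebra_simps)
    then show ?thesis using assms e by (intro divide_right_mono powr_mono2) auto
  qed
  also have "\<dots> = (exp 1 + 1) powr q / q * x powr q"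
    using assms e by (simp add: powr_mult)
  finally have "ln (exp 1 + x) powr \<alpha> \<le> ((exp 1 + 1) powr q / q * x powr q) powr \<alpha>"
    using assms e by (intro powr_mono2 ln_ge_zero) (linarith)+
  also have "\<dots> = ((exp 1 + 1) powr q / q) powr \<alpha> * x powr (q * \<alpha>)"
    using assms by (subst powr_mult) (auto simp: powr_powr)
  finally have "x * ln (exp 1 + x) powr \<alpha> \<le> x * (((exp 1 + 1) powr q / q) powr \<alpha> * x powr (q * \<alpha>))"
    using assms by (intro mult_left_mono) auto
  also have "\<dots> = ((exp 1 + 1) powr q / q) powr \<alpha> * x powr (1 + q * \<alpha>)"
    using assms by (simp add: powr_add)
  finally show ?thesis .
qed

text \<open>
  The singularities of \<open>\<Omega>\<close> lie at the two points orthogonal to \<open>\<xi> = circle_point (pi / 2)\<close>, where the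
  kernel at \<open>\<xi>\<close> is singular as well.
\<close>
lemma LlogL_K_norm_infinite:
  fixes a \<alpha> :: real
  assumes "0 < a" "a < 1" "0 < \<alpha>"
  shows "\<exists>\<Omega>. \<Omega> \<in> LlogL \<alpha> \<and> K_norm a \<Omega> = \<infinity>"
proof -
  define \<Omega> :: "real ^ 2 \<Rightarrow> real" where "\<Omega> \<theta> = \<bar>\<theta> $ 2\<bar> powr (a - 1)" for \<theta>
  have "(\<lambda>\<theta> :: real ^ 2. \<theta> $ 2) \<in> borel_measurable borel"
    by (intro borel_measurable_continuous_onI continuous_intros)
  then have [measurable]: "(\<lambda>\<theta> :: real ^ 2. \<theta> $ 2) \<in> borel_measurable arc_length"
    by (rule borel_measurable_arc_length)
  have \<Omega> [measurable]: "\<Omega> \<in> borel_measurable arc_length" unfolding \<Omega>_def by measurable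
  have "(\<integral>\<^sup>+\<theta>. ennreal (\<bar>\<Omega> \<theta>\<bar> * ln (exp 1 + \<bar>\<Omega> \<theta>\<bar>) powr \<alpha>) \<partial>arc_length) < \<infinity>" (is "?I < _")
  proof -
    \<comment> \<open>With this \<open>q\<close>, raising \<open>\<Omega> = \<bar>sin t\<bar>\<^sup>a\<^sup>-\<^sup>1\<close> to the power \<open>1 + q \<alpha>\<close> gives exponent \<open>- b\<close>, where \<open>b\<close> is
      halfway between \<open>1 - a\<close> and the critical exponent \<open>1\<close>.\<close>
    define q where "q = a / (2 * (1 - a) * \<alpha>)"
    define b where "b = 1 - a / 2"
    define K where "K = ((exp 1 + 1) powr q / q) powr \<alpha>"
    have q: "0 < q" using assms by (simp add: q_def)
    have exponent: "(a - 1) * (1 + q * \<alpha>) = - b"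
      using assms by (simp add: q_def b_def field_simps)
    have pt: "ennreal (\<bar>\<Omega> (circle_point t)\<bar> * ln (exp 1 + \<bar>\<Omega> (circle_point t)\<bar>) powr \<alpha>)
      \<le> ennreal K * sin_kernel b t" for t
    proof (cases "sin t = 0")
      case False
      let ?x = "\<bar>sin t\<bar> powr (a - 1)"
      have "1 \<le> ?x" using powr_mono2'[of "a - 1" "\<bar>sin t\<bar>" 1] False assms by simp
      then have "?x * ln (exp 1 + ?x) powr \<alpha> \<le> K * ?x powr (1 + q * \<alpha>)"
        unfolding K_def using q assms(3) by (rule mult_ln_powr_le_powr)
      also have "?x powr (1 + q * \<alpha>) = inverse (\<bar>sin t\<bar> powr b)"
        by (simp add: powr_powr exponent powr_minus)
      finally show ?thesis using False
        by (simp add: \<Omega>_def sin_kernel_def inverse_ennreal ennreal_mult[symmetric] K_def ennreal_leI)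
    qed (simp add: \<Omega>_def)
    have "?I = (\<integral>\<^sup>+t. ennreal (\<bar>\<Omega> (circle_point t)\<bar> * ln (exp 1 + \<bar>\<Omega> (circle_point t)\<bar>) powr \<alpha>)
        * indicator {0..<2 * pi} t \<partial>lborel)"
      by (rule nn_integral_arc_length) measurable
    also have "\<dots> \<le> (\<integral>\<^sup>+t. ennreal K * (sin_kernel b t * indicator {- (2 * pi)..2 * pi} t) \<partial>lborel)"
    proof (rule nn_integral_mono)
      fix t :: real
      have "0 \<le> t \<Longrightarrow> - (2 * pi) \<le> t" using pi_gt_zero by linarith
      then show "ennreal (\<bar>\<Omega> (circle_point t)\<bar> * ln (exp 1 + \<bar>\<Omega> (circle_point t)\<bar>) powr \<alpha>)
        * indicator {0..<2 * pi} t \<le> ennreal K * (sin_kernel b t * indicator {- (2 * pi)..2 * pi} t)"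
        using pt[of t] by (simp split: split_indicator)
    qed
    also have "\<dots> = ennreal K * (\<integral>\<^sup>+t. sin_kernel b t * indicator {- (2 * pi)..2 * pi} t \<partial>lborel)"
      by (rule nn_integral_cmult) measurable
    also have "\<dots> < \<infinity>"
      using nn_integral_sin_kernel_finite[of b] assms by (simp add: b_def ennreal_mult_less_top)
    finally show ?thesis .
  qed
  then have "\<Omega> \<in> LlogL \<alpha>" by (simp add: LlogL_def)
  moreover have "K_norm a \<Omega> = \<infinity>"
  proof -
    let ?\<xi> = "circle_point (pi / 2)"
    have inner: "circle_point t \<bullet> ?\<xi> = sin t" for t by (simp add: inner_vec_def sum_2)
    let ?f = "\<lambda>\<theta>. ennreal \<bar>\<Omega> \<theta>\<bar> / ennreal (\<bar>\<theta> \<bullet> ?\<xi>\<bar> powr a)"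
    have [measurable]: "(\<lambda>\<theta>. \<bar>\<theta> \<bullet> ?\<xi>\<bar> powr a) \<in> borel_measurable arc_length"
      by (rule borel_measurable_arc_length) measurable
    have "\<infinity> = (\<integral>\<^sup>+t. ennreal (1 / t) * indicator {0<..1} t \<partial>lborel)"
      by (simp add: nn_integral_reciprocal_infinite)
    also have "\<dots> \<le> (\<integral>\<^sup>+t. ?f (circle_point t) * indicator {0..<2 * pi} t \<partial>lborel)"
    proof (rule nn_integral_mono)
      fix t :: real
      show "ennreal (1 / t) * indicator {0<..1} t \<le> ?f (circle_point t) * indicator {0..<2 * pi} t"
      proof (cases "t \<in> {0<..1}")
        case True
        then have s: "0 < sin t" "sin t \<le> t" using pi_gt3 by (auto intro: sin_gt_zero sin_x_le_x)
        have "?f (circle_point t) = ennreal (sin t powr (a - 1) / sin t powr a)"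
          unfolding inner using s by (simp add: \<Omega>_def divide_ennreal)
        also have "sin t powr (a - 1) / sin t powr a = 1 / sin t"
          using s by (simp add: powr_diff[symmetric] powr_minus_divide)
        finally have "ennreal (1 / t) \<le> ?f (circle_point t)"
          using s True by (simp add: ennreal_leI frac_le)
        moreover have "t \<in> {0..<2 * pi}" using True pi_gt3 by auto
        ultimately show ?thesis using True by simp
      qed simp
    qed
    also have "\<dots> = (\<integral>\<^sup>+\<theta>. ?f \<theta> \<partial>arc_length)"
      by (rule nn_integral_arc_length[symmetric]) measurable
    also have "\<dots> \<le> K_norm a \<Omega>"
      unfolding K_norm_def using circle_point_in_circle by (rule SUP_upper)
    finally show ?thesis by (simp add: top_unique)
  qed
  ultimately show ?thesis by blast
qed

theorem theorem1p4:
  fixes a \<alpha> :: real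
  assumes "0 < a" and "a < 1" and "\<alpha> > 1"
  shows "(\<exists>\<Omega>. integrable arc_length \<Omega> \<and> K_norm a \<Omega> < \<infinity> \<and> \<Omega> \<notin> LlogL \<alpha>)
       \<and> (\<exists>\<Omega>. \<Omega> \<in> LlogL \<alpha> \<and> K_norm a \<Omega> = \<infinity>)"
  using K_norm_finite_not_LlogL[of a \<alpha>] LlogL_K_norm_infinite[of a \<alpha>] assms by auto

end
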